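(* A nontrivial connected graph $G$ of order $n$ with $\gamma(G) \ge 4$ is a universal fixer if and only if $G = \overline{K_n}$.
   Context: All graphs are finite, simple and undirected. The order of $G$ is $|V(G)|$; a nontrivial graph is one of order at least $2$ (so, in particular, a nontrivial connected graph is never edgeless, and the theorem says that no nontrivial connected graph with $\gamma(G)\ge 4$ is a universal fixer). $\overline{K_n}$ denotes the graph consisting of $n$ isolated vertices. A set $D \subseteq V(G)$ dominates $G$ if every vertex of $G$ is in $D$ or adjacent to a vertex of $D$; the domination number $\gamma(G)$ is the minimum cardinality of a dominating set of $G$. Given a graph $G$ and a permutation $\pi$ of $V(G)$ (any bijection $V(G)\to V(G)$), the graph $\pi G$ is obtained by taking two disjoint copies $G^1$ and $G^2$ of $G$ and joining every $u \in V(G^1)$ by an edge to $\pi(u) \in V(G^2)$. $G$ is a universal fixer if $\gamma(\pi G) = \gamma(G)$ for every permutation $\pi$ of $V(G)$. *)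

theory Defs
  imports "Graph_Theory.Digraph_Isomorphism"
begin

text \<open>
  A finite simple undirected graph is a \<^locale>\<open>pair_graph\<close>: a finite loop-free symmetric digraph
  whose arcs are pairs of vertices, so that an edge \<open>uv\<close> is the pair of arcs \<open>(u, v)\<close>, \<open>(v, u)\<close>.
\<close>

definition dominating_set :: "'a pair_pre_digraph \<Rightarrow> 'a set \<Rightarrow> bool" where
  "dominating_set G D \<longleftrightarrow>
     D \<subseteq> pverts G \<and> (\<forall>v \<in> pverts G. v \<in> D \<or> (\<exists>u \<in> D. (u, v) \<in> parcs G))"

definition domination_number :: "'a pair_pre_digraph \<Rightarrow> nat" where
  "domination_number G = Min {card D | D. dominating_set G D}"

text \<open>
  \<open>prism \<pi> G\<close> is the graph \<open>\<pi>G\<close>: the two disjoint copies of \<open>G\<close> are tagged by \<open>Inl\<close> and \<open>Inr\<close>.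
  Only the values of \<open>\<pi>\<close> on the vertices of \<open>G\<close> enter, so \<open>\<pi>\<close> is unconstrained elsewhere.
\<close>

definition prism :: "('a \<Rightarrow> 'a) \<Rightarrow> 'a pair_pre_digraph \<Rightarrow> ('a + 'a) pair_pre_digraph" where
  "prism \<pi> G =
     \<lparr> pverts = Inl ` pverts G \<union> Inr ` pverts G,
       parcs = {(Inl u, Inl v) | u v. (u, v) \<in> parcs G}
             \<union> {(Inr u, Inr v) | u v. (u, v) \<in> parcs G}
             \<union> {(Inl u, Inr (\<pi> u)) | u. u \<in> pverts G}
             \<union> {(Inr (\<pi> u), Inl u) | u. u \<in> pverts G} \<rparr>"

definition universal_fixer :: "'a pair_pre_digraph \<Rightarrow> bool" where
  "universal_fixer G \<longleftrightarrow>
     (\<forall>\<pi>. bij_betw \<pi> (pverts G) (pverts G) \<longrightarrow> domination_number (prism \<pi> G) = domination_number G)"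

definition edgeless_graph :: "nat \<Rightarrow> nat pair_pre_digraph" where
  "edgeless_graph n = \<lparr> pverts = {..<n}, parcs = {} \<rparr>"

lemma pair_graph_edgeless_graph: "pair_graph (edgeless_graph n)"
  by unfold_locales (auto simp: edgeless_graph_def symmetric_def sym_def)

lemma pair_graph_prism:
  assumes "pair_graph G" and "bij_betw \<pi> (pverts G) (pverts G)"
  shows "pair_graph (prism \<pi> G)"
proof -
  interpret pair_graph G by fact
  have \<pi>: "\<pi> u \<in> pverts G" if "u \<in> pverts G" for u
    using assms(2) that by (auto simp: bij_betw_def)
  have sub: "parcs (prism \<pi> G) \<subseteq> pverts (prism \<pi> G) \<times> pverts (prism \<pi> G)"
    using \<pi> by (auto simp: prism_def dest: in_arcsD1 in_arcsD2)
  have fin: "finite (pverts (prism \<pi> G))"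
    by (simp add: prism_def pair_finite_verts)
  show ?thesis
  proof
    show "finite (parcs (prism \<pi> G))"
      using sub fin by (meson finite_SigmaI finite_subset)
    show "symmetric (with_proj (prism \<pi> G))"
      by (auto simp: symmetric_def sym_def prism_def intro: arcs_symmetric)
  qed (use \<pi> fin in \<open>auto simp: prism_def dest: in_arcsD1 in_arcsD2 no_loops'\<close>)
qed

end

theory Submission
  imports Defs "HOL-Combinatorics.Transposition"
begin

text \<open>
  Both sides of the equivalence are false. A connected graph of order at least two has an edge, so
  it is not isomorphic to an edgeless graph, and no graph with an edge is a universal fixer: for a
  vertex \<open>x\<close> with a neighbour there is a permutation \<open>\<pi>\<close> that moves only the closed neighbourhood
  \<open>M = N[x]\<close> and has \<open>\<gamma>(\<pi>G) \<noteq> \<gamma>(G)\<close>.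

  Suppose that some dominating set of \<open>\<pi>G\<close> has \<open>\<gamma>(G)\<close> elements. Let \<open>A\<close> be its part in the first
  copy and \<open>Y\<close> the \<open>\<pi>\<close>-preimage of its part in the second. Then \<open>A\<close> dominates every vertex outside
  \<open>Y\<close>, and \<open>\<pi>(Y)\<close> dominates every vertex outside \<open>\<pi>(A)\<close>. As \<open>|A| + |Y| = \<gamma>(G)\<close>, nothing may be wasted:
  no vertex of \<open>A\<close> dominates a vertex of \<open>Y\<close> (\<open>split_dominates_separated\<close>), no vertex of \<open>G\<close>
  dominates two vertices of \<open>Y\<close> (\<open>split_dominates_packing\<close>), and the same holds for the pair
  \<open>\<pi>(Y)\<close>, \<open>\<pi>(A)\<close>. If \<open>\<pi>\<close> permutes \<open>M\<close> without fixed points and is the identity outside \<open>M\<close>, it follows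
  that \<open>A\<close> and \<open>Y\<close> meet \<open>M\<close> in one vertex each, \<open>p\<close> and \<open>q\<close>, and that within \<open>M\<close> the closed
  neighbourhood of \<open>\<pi>(p)\<close> is obtained from that of \<open>p\<close> by removing vertices, \<open>\<pi>(q)\<close> among them, and
  possibly adding \<open>q\<close> (\<open>rotation_of_closed_nbhd\<close>).

  This is prevented by letting \<open>\<pi>\<close> follow a well-chosen numbering \<open>g\<close> of \<open>M\<close> that starts at \<open>x\<close>, so
  that \<open>g(\<pi>(p)) = g(p) + 1\<close> and \<open>g(\<pi>(q)) = g(q) + 1\<close>. Let \<open>W(v)\<close> be the sum of \<open>g\<close> over the closed
  neighbourhood of \<open>v\<close> in \<open>M\<close>. The exchange of \<open>\<pi>(q)\<close> for at most \<open>q\<close> gives \<open>W(\<pi>(p)) < W(p)\<close>. But if \<open>g\<close> is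
  chosen to maximise the sum of \<open>g(u) g(v)\<close> over all ordered pairs of equal or adjacent \<open>u, v \<in> M\<close>,
  then swapping the numbers of \<open>p\<close> and \<open>\<pi>(p)\<close> cannot increase that sum, and this says
  \<open>W(p) \<le> W(\<pi>(p))\<close> (\<open>exists_optimal_numbering\<close>).
\<close>

section \<open>Domination and split domination\<close>

definition closed_nbhd :: "'a pair_pre_digraph \<Rightarrow> 'a \<Rightarrow> 'a set" where
  "closed_nbhd G v = {u \<in> pverts G. u = v \<or> (v, u) \<in> parcs G}"

text \<open>
  A dominating set of a prism imposes on each copy of the graph that one set dominates everything
  except for a second set, whose vertices are taken care of from the other copy.
\<close>

definition split_dominates :: "'a pair_pre_digraph \<Rightarrow> 'a set \<Rightarrow> 'a set \<Rightarrow> bool" where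
  "split_dominates G A Y \<longleftrightarrow>
     A \<subseteq> pverts G \<and> Y \<subseteq> pverts G \<and> (\<forall>v \<in> pverts G. v \<in> Y \<or> (\<exists>a \<in> A. v \<in> closed_nbhd G a))"

context pair_graph
begin

lemma closed_nbhd_commute: "u \<in> closed_nbhd G v \<Longrightarrow> v \<in> closed_nbhd G u"
  by (auto simp: closed_nbhd_def intro: arcs_symmetric dest: in_arcsD1)

lemma dominating_set_iff_closed_nbhd:
  "dominating_set G D \<longleftrightarrow> D \<subseteq> pverts G \<and> (\<forall>v \<in> pverts G. \<exists>u \<in> D. v \<in> closed_nbhd G u)"
  unfolding dominating_set_def closed_nbhd_def by blast

lemma finite_dominating_set_cards: "finite {card D | D. dominating_set G D}"
proof -
  have "{card D | D. dominating_set G D} \<subseteq> card ` Pow (pverts G)"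
    by (auto simp: dominating_set_def)
  then show ?thesis
    by (rule finite_subset) simp
qed

lemma domination_number_le: "dominating_set G D \<Longrightarrow> domination_number G \<le> card D"
  unfolding domination_number_def by (rule Min_le[OF finite_dominating_set_cards]) blast

lemma domination_number_attained: "\<exists>D. dominating_set G D \<and> card D = domination_number G"
proof -
  have "dominating_set G (pverts G)"
    by (simp add: dominating_set_def)
  then have "{card D | D. dominating_set G D} \<noteq> {}"
    by blast
  from Min_in[OF finite_dominating_set_cards this] show ?thesis
    unfolding domination_number_def by auto
qed

text \<open>
  If \<open>a\<close> dominated \<open>y\<close>, then \<open>A \<union> (Y - {y})\<close> would still be a dominating set, and it is too small.
\<close>

lemma split_dominates_separated:
  assumes split: "split_dominates G A Y" and min: "card A + card Y \<le> domination_number G"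
    and "a \<in> A" "y \<in> Y"
  shows "y \<notin> closed_nbhd G a"
proof
  assume y: "y \<in> closed_nbhd G a"
  have sub: "A \<subseteq> pverts G" "Y \<subseteq> pverts G"
    using split by (auto simp: split_dominates_def)
  then have fin: "finite A" "finite Y"
    using finite_subset pair_finite_verts by blast+
  have "\<exists>u \<in> A \<union> (Y - {y}). v \<in> closed_nbhd G u" if v: "v \<in> pverts G" for v
  proof (cases "v \<in> Y - {y}")
    case True
    with v show ?thesis
      by (auto simp: closed_nbhd_def)
  next
    case False
    with v split y \<open>a \<in> A\<close> show ?thesis
      unfolding split_dominates_def by blast
  qed
  with sub have "dominating_set G (A \<union> (Y - {y}))"
    unfolding dominating_set_iff_closed_nbhd by blast
  then have "domination_number G \<le> card (A \<union> (Y - {y}))"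
    by (rule domination_number_le)
  also have "\<dots> \<le> card A + card (Y - {y})"
    by (rule card_Un_le)
  also have "\<dots> < card A + card Y"
    using fin \<open>y \<in> Y\<close> by (intro add_strict_left_mono card_Diff1_less)
  finally show False
    using min by simp
qed

text \<open>
  A vertex \<open>z\<close> that dominates two vertices of \<open>Y\<close> could replace both of them in the dominating set
  \<open>A \<union> Y\<close>.
\<close>

lemma split_dominates_packing:
  assumes split: "split_dominates G A Y" and min: "card A + card Y \<le> domination_number G"
    and y: "y \<in> Y" "y \<in> closed_nbhd G z" and y': "y' \<in> Y" "y' \<in> closed_nbhd G z"
    and z: "z \<in> pverts G"
  shows "y = y'"
proof (rule ccontr)
  assume ne: "y \<noteq> y'"
  have sub: "A \<subseteq> pverts G" "Y \<subseteq> pverts G"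
    using split by (auto simp: split_dominates_def)
  then have fin: "finite A" "finite Y"
    using finite_subset pair_finite_verts by blast+
  have "\<exists>u \<in> insert z (A \<union> (Y - {y, y'})). v \<in> closed_nbhd G u" if v: "v \<in> pverts G" for v
  proof (cases "v \<in> Y - {y, y'}")
    case True
    with v show ?thesis
      by (auto simp: closed_nbhd_def)
  next
    case False
    with v split y y' show ?thesis
      unfolding split_dominates_def by blast
  qed
  with sub z have "dominating_set G (insert z (A \<union> (Y - {y, y'})))"
    unfolding dominating_set_iff_closed_nbhd by blast
  then have "domination_number G \<le> card (insert z (A \<union> (Y - {y, y'})))"
    by (rule domination_number_le)
  also have "\<dots> \<le> Suc (card (A \<union> (Y - {y, y'})))"
    by (rule card_insert_le_m1) simp_all
  also have "\<dots> \<le> Suc (card A + card (Y - {y, y'}))"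
    by (simp add: card_Un_le)
  also have "\<dots> < card A + card Y"
  proof -
    have "card {y, y'} \<le> card Y"
      using y y' fin by (intro card_mono) auto
    then show ?thesis
      using ne y y' fin by (simp add: card_Diff_subset)
  qed
  finally show False
    using min by simp
qed

text \<open>
  Pulling the second copy back along \<open>\<pi>\<close> places both parts of a dominating set in the one vertex set
  of \<open>G\<close>. The two resulting conditions are exchanged when \<open>\<pi>\<close> is replaced by its inverse, so each
  consequence of the first has a mirror image for the second.
\<close>

lemma prism_dominating_set_splits:
  assumes bij: "bij_betw \<pi> (pverts G) (pverts G)" and dom: "dominating_set (prism \<pi> G) D"
  obtains A Y where "split_dominates G A Y" "split_dominates G (\<pi> ` Y) (\<pi> ` A)"
    "card A + card Y = card D"
proof
  define A where "A = Inl -` D"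
  define B where "B = Inr -` D"
  define Y where "Y = {v \<in> pverts G. \<pi> v \<in> B}"
  have D: "D = Inl ` A \<union> Inr ` B"
  proof -
    have "d \<in> Inl ` A \<union> Inr ` B" if "d \<in> D" for d
      using that unfolding A_def B_def by (cases d) auto
    then show ?thesis
      by (auto simp: A_def B_def)
  qed
  have sub: "A \<subseteq> pverts G" "B \<subseteq> pverts G"
    using dom by (auto simp: dominating_set_def prism_def A_def B_def)
  then have fin: "finite A" "finite B"
    using finite_subset pair_finite_verts by blast+
  have imY: "\<pi> ` Y = B"
    using bij sub by (fastforce simp: Y_def bij_betw_def)
  have "card B = card Y"
    using bij unfolding imY[symmetric]
    by (intro card_image) (auto simp: Y_def bij_betw_def inj_on_def)
  moreover have "card D = card A + card B"
    using fin unfolding D by (subst card_Un_disjoint) (auto simp: card_image)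
  ultimately show "card A + card Y = card D"
    by simp
  have "v \<in> Y \<or> (\<exists>a \<in> A. v \<in> closed_nbhd G a)" if v: "v \<in> pverts G" for v
  proof -
    have "Inl v \<in> D \<or> (\<exists>u \<in> D. (u, Inl v) \<in> parcs (prism \<pi> G))"
      using dom v by (auto simp: dominating_set_def prism_def)
    then show ?thesis
      using v by (auto simp: prism_def A_def B_def Y_def closed_nbhd_def)
  qed
  then show "split_dominates G A Y"
    using sub by (auto simp: split_dominates_def Y_def)
  have "v \<in> \<pi> ` A \<or> (\<exists>b \<in> B. v \<in> closed_nbhd G b)" if v: "v \<in> pverts G" for v
  proof -
    have "Inr v \<in> D \<or> (\<exists>u \<in> D. (u, Inr v) \<in> parcs (prism \<pi> G))"
      using dom v by (auto simp: dominating_set_def prism_def)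
    then show ?thesis
      using v by (auto simp: prism_def A_def B_def closed_nbhd_def)
  qed
  moreover have "\<pi> ` A \<subseteq> pverts G"
    using bij sub by (auto simp: bij_betw_def)
  ultimately show "split_dominates G (\<pi> ` Y) (\<pi> ` A)"
    using sub unfolding imY by (auto simp: split_dominates_def)
qed

end

section \<open>Numberings and rotations\<close>

text \<open>
  The sum over related pairs is a quadratic form in \<open>h\<close>. The first-order effect of changing \<open>h\<close> by the
  vector \<open>e\<close> that is 1 at \<open>p\<close> and -1 at \<open>p'\<close> is \<open>2 (W p - W p')\<close>, where \<open>W v\<close> sums \<open>h\<close> over the
  elements related to \<open>v\<close>; the second-order effect is \<open>2\<close> or \<open>0\<close>, according to whether \<open>p\<close> and \<open>p'\<close>
  are unrelated or related, hence never negative.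
\<close>

lemma numbering_swap_gain:
  fixes h :: "'a \<Rightarrow> int"
  assumes M: "finite M" and "p \<in> M" "p' \<in> M" "p \<noteq> p'"
    and refl: "\<And>v. v \<in> M \<Longrightarrow> R v v" and sym: "\<And>u v. R u v \<Longrightarrow> R v u"
  shows "(\<Sum>u\<in>M. \<Sum>v | v \<in> M \<and> R u v. h u * h v)
      + 2 * ((\<Sum>v | v \<in> M \<and> R p v. h v) - (\<Sum>v | v \<in> M \<and> R p' v. h v))
    \<le> (\<Sum>u\<in>M. \<Sum>v | v \<in> M \<and> R u v. (h(p := h p + 1, p' := h p' - 1)) u * (h(p := h p + 1, p' := h p' - 1)) v)"
proof -
  define c where "c u v = (of_bool (R u v) :: int)" for u v
  define e where "e v = (of_bool (v = p) - of_bool (v = p') :: int)" for v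
  define W where "W u = (\<Sum>v\<in>M. c u v * h v)" for u
  have restrict: "(\<Sum>v | v \<in> M \<and> R u v. k v) = (\<Sum>v\<in>M. c u v * k v)" for u and k :: "'a \<Rightarrow> int"
    using M by (intro sum.mono_neutral_cong_left) (auto simp: c_def)
  have csym: "c u v = c v u" for u v
    using sym by (auto simp: c_def)
  have e_sum: "(\<Sum>v\<in>M. e v * k v) = k p - k p'" for k :: "'a \<Rightarrow> int"
  proof -
    have "(\<Sum>v\<in>M. e v * k v) = (\<Sum>v\<in>M. (if v = p then k v else 0) - (if v = p' then k v else 0))"
      by (rule sum.cong) (auto simp: e_def)
    then show ?thesis
      using assms by (simp add: sum_subtractf)
  qed
  have upd: "h(p := h p + 1, p' := h p' - 1) = (\<lambda>v. h v + e v)"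
    using \<open>p \<noteq> p'\<close> by (auto simp: e_def)
  have We: "(\<Sum>v\<in>M. c u v * e v) = c u p - c u p'" for u
    using e_sum[of "c u"] by (simp add: mult.commute)
  have row: "(\<Sum>v\<in>M. c u v * ((h u + e u) * (h v + e v)))
      = h u * W u + e u * W u + h u * (c u p - c u p') + e u * (c u p - c u p')" for u
  proof -
    have "(\<Sum>v\<in>M. c u v * ((h u + e u) * (h v + e v)))
        = (\<Sum>v\<in>M. (h u + e u) * (c u v * h v) + (h u + e u) * (c u v * e v))"
      by (rule sum.cong) (simp_all only: algebra_simps)
    also have "\<dots> = (h u + e u) * W u + (h u + e u) * (c u p - c u p')"
      by (simp only: sum.distrib sum_distrib_left[symmetric] We W_def)
    finally show ?thesis
      by (simp only: algebra_simps)
  qed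
  have "(\<Sum>u\<in>M. \<Sum>v\<in>M. c u v * ((h u + e u) * (h v + e v)))
      = (\<Sum>u\<in>M. h u * W u + e u * W u + h u * (c u p - c u p') + e u * (c u p - c u p'))"
    by (simp only: row)
  also have "\<dots> = (\<Sum>u\<in>M. h u * W u) + (\<Sum>u\<in>M. e u * W u)
      + ((\<Sum>u\<in>M. h u * c u p) - (\<Sum>u\<in>M. h u * c u p')) + (\<Sum>u\<in>M. e u * (c u p - c u p'))"
    by (simp add: sum.distrib right_diff_distrib sum_subtractf)
  also have "(\<Sum>u\<in>M. h u * c u p) = W p"
    by (simp add: W_def csym[of p] mult.commute)
  also have "(\<Sum>u\<in>M. h u * c u p') = W p'"
    by (simp add: W_def csym[of p'] mult.commute)
  finally have eq: "(\<Sum>u\<in>M. \<Sum>v\<in>M. c u v * ((h u + e u) * (h v + e v)))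
      = (\<Sum>u\<in>M. h u * W u) + 2 * (W p - W p') + ((c p p - c p p') - (c p' p - c p' p'))"
    by (simp add: e_sum)
  have "(c p p - c p p') - (c p' p - c p' p') \<ge> 0"
    using refl[OF \<open>p \<in> M\<close>] refl[OF \<open>p' \<in> M\<close>] by (simp add: c_def)
  moreover have "(\<Sum>u\<in>M. \<Sum>v\<in>M. c u v * (h u * h v)) = (\<Sum>u\<in>M. h u * W u)"
    unfolding W_def by (simp only: sum_distrib_left mult.left_commute)
  ultimately show ?thesis
    unfolding upd restrict W_def[symmetric] using eq by linarith
qed

text \<open>
  The numbering is a maximiser of the quadratic form of the previous lemma among the numberings with
  \<open>g x = 0\<close>. When \<open>p\<close> and \<open>p'\<close> carry consecutive numbers, the change by \<open>e\<close> is exactly the swap of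
  these numbers, so it leads to another competitor and the gain cannot be positive.
\<close>

lemma exists_optimal_numbering:
  assumes M: "finite M" and x: "x \<in> M"
    and refl: "\<And>v. v \<in> M \<Longrightarrow> R v v" and sym: "\<And>u v. R u v \<Longrightarrow> R v u"
  obtains g :: "'a \<Rightarrow> nat" where "bij_betw g M {..<card M}" "g x = 0"
    "\<And>p p'. \<lbrakk>p \<in> M; p' \<in> M; p \<noteq> x; g p' = Suc (g p)\<rbrakk>
      \<Longrightarrow> (\<Sum>v | v \<in> M \<and> R p v. g v) \<le> (\<Sum>v | v \<in> M \<and> R p' v. g v)"
proof -
  define P where "P g \<longleftrightarrow> bij_betw g M {..<card M} \<and> g x = 0" for g :: "'a \<Rightarrow> nat"
  define Q where "Q g = (\<Sum>u\<in>M. \<Sum>v | v \<in> M \<and> R u v. g u * g v)" for g :: "'a \<Rightarrow> nat"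
  obtain h where h: "bij_betw h M {0..<card M}"
    using ex_bij_betw_finite_nat[OF M] by blast
  have "h x < card M"
    using bij_betwE[OF h] x by simp
  then have "bij_betw (transpose (h x) 0) {0..<card M} {0..<card M}"
    by (intro bij_betw_byWitness[of _ "transpose (h x) 0"]) (auto simp: transpose_def)
  from bij_betw_trans[OF h this] have "P (transpose (h x) 0 \<circ> h)"
    by (simp add: P_def atLeast0LessThan)
  moreover have "\<forall>g. P g \<longrightarrow> Q g < Suc (\<Sum>u\<in>M. \<Sum>v | v \<in> M \<and> R u v. card M * card M)"
  proof (intro allI impI)
    fix g :: "'a \<Rightarrow> nat" assume "P g"
    then have g: "bij_betw g M {..<card M}"
      by (simp add: P_def)
    have "g v \<le> card M" if "v \<in> M" for v
      using bij_betwE[OF g] that by (simp add: less_imp_le)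
    then show "Q g < Suc (\<Sum>u\<in>M. \<Sum>v | v \<in> M \<and> R u v. card M * card M)"
      unfolding Q_def less_Suc_eq_le by (intro sum_mono mult_mono) simp_all
  qed
  ultimately have "\<exists>g. P g \<and> (\<forall>g'. P g' \<longrightarrow> Q g' \<le> Q g)"
    by (rule ex_has_greatest_nat)
  then obtain g where g: "P g" and max: "\<forall>g'. P g' \<longrightarrow> Q g' \<le> Q g"
    by auto
  show ?thesis
  proof
    show "bij_betw g M {..<card M}" "g x = 0"
      using g by (simp_all add: P_def)
  next
    fix p p' assume p: "p \<in> M" "p' \<in> M" "p \<noteq> x" and succ: "g p' = Suc (g p)"
    define g' where "g' = g(p := g p', p' := g p)"
    have ne: "p \<noteq> p'" "p' \<noteq> x"
      using succ g by (auto simp: P_def)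
    have "bij_betw (transpose p p') M M"
      using p by (intro bij_betw_byWitness[of _ "transpose p p'"]) (auto simp: transpose_def)
    then have "bij_betw (g \<circ> transpose p p') M {..<card M}"
      by (rule bij_betw_trans) (use g in \<open>simp add: P_def\<close>)
    moreover have "g \<circ> transpose p p' = g'"
      using ne by (auto simp: g'_def transpose_def)
    ultimately have "P g'"
      using g p ne by (simp add: P_def g'_def)
    then have le: "int (Q g') \<le> int (Q g)"
      using max by simp
    have cast: "(\<lambda>v. int (g' v)) = (\<lambda>v. int (g v))(p := int (g p) + 1, p' := int (g p') - 1)"
      using succ by (auto simp: g'_def)
    define W where "W u = (\<Sum>v | v \<in> M \<and> R u v. g v)" for u
    have "int (Q g) + 2 * (int (W p) - int (W p')) \<le> int (Q g')"
      using numbering_swap_gain[of M p p' R "\<lambda>v. int (g v)", OF M p(1,2) ne(1) refl sym]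
      unfolding cast[symmetric] Q_def W_def of_nat_sum of_nat_mult .
    with le have "W p \<le> W p'"
      by presburger
    then show "(\<Sum>v | v \<in> M \<and> R p v. g v) \<le> (\<Sum>v | v \<in> M \<and> R p' v. g v)"
      by (simp only: W_def)
  qed
qed

text \<open>
  The numbers count modulo \<open>card M\<close>, so a step that does not end at the number 0 raises the
  number by exactly one. There are no fixed points because \<open>M\<close> has at least two elements.
\<close>

lemma rotation_along_numbering:
  fixes g :: "'a \<Rightarrow> nat"
  assumes "M \<subseteq> V" and g: "bij_betw g M {..<card M}" and "card M \<ge> 2"
  obtains \<pi> where "bij_betw \<pi> V V" "\<And>v. v \<notin> M \<Longrightarrow> \<pi> v = v" "\<And>v. v \<in> M \<Longrightarrow> \<pi> v \<in> M"
    "\<And>v. v \<in> M \<Longrightarrow> \<pi> v \<noteq> v" "\<And>v. \<lbrakk>v \<in> M; g (\<pi> v) \<noteq> 0\<rbrakk> \<Longrightarrow> g (\<pi> v) = Suc (g v)"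
proof
  define \<rho> where "\<rho> v = inv_into M g (Suc (g v) mod card M)" for v
  define \<pi> where "\<pi> v = (if v \<in> M then \<rho> v else v)" for v
  have lt: "g v < card M" if "v \<in> M" for v
    using g that by (auto simp: bij_betw_def)
  have \<rho>: "\<rho> v \<in> M" "g (\<rho> v) = Suc (g v) mod card M" if "v \<in> M" for v
  proof -
    have "Suc (g v) mod card M \<in> g ` M"
      using g \<open>card M \<ge> 2\<close> by (auto simp: bij_betw_def)
    then show "\<rho> v \<in> M" "g (\<rho> v) = Suc (g v) mod card M"
      unfolding \<rho>_def by (rule inv_into_into, rule f_inv_into_f)
  qed
  have mod_Suc_cases: "Suc (g v) mod card M = (if Suc (g v) = card M then 0 else Suc (g v))"
    if "v \<in> M" for v
    using lt[OF that] by auto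
  have "inj_on \<rho> M"
  proof (rule inj_onI)
    fix u v assume uv: "u \<in> M" "v \<in> M" "\<rho> u = \<rho> v"
    then have "Suc (g u) mod card M = Suc (g v) mod card M"
      using \<rho>(2) by metis
    then have "g u = g v"
      using uv by (simp add: mod_Suc_cases split: if_splits)
    then show "u = v"
      using g uv by (auto simp: bij_betw_def inj_on_def)
  qed
  moreover have "finite M"
    using \<open>card M \<ge> 2\<close> by (intro card_ge_0_finite) simp
  ultimately have "bij_betw \<rho> M M"
    using \<rho>(1) endo_inj_surj[of M \<rho>] by (auto simp: bij_betw_def)
  then have "bij_betw \<pi> M M"
    by (rule bij_betw_cong[THEN iffD1, rotated]) (simp add: \<pi>_def)
  moreover have "bij_betw \<pi> (V - M) (V - M)"
    by (rule bij_betw_cong[THEN iffD1, OF _ bij_betw_id]) (simp add: \<pi>_def)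
  ultimately have "bij_betw \<pi> (M \<union> (V - M)) (M \<union> (V - M))"
    by (rule bij_betw_combine) auto
  with \<open>M \<subseteq> V\<close> show "bij_betw \<pi> V V"
    by (simp add: Un_absorb1)
  show "\<pi> v = v" if "v \<notin> M" for v
    using that by (simp add: \<pi>_def)
  fix v assume v: "v \<in> M"
  then show "\<pi> v \<in> M"
    using \<rho> by (simp add: \<pi>_def)
  have g\<pi>: "g (\<pi> v) = (if Suc (g v) = card M then 0 else Suc (g v))"
    using v \<rho>(2) mod_Suc_cases by (simp add: \<pi>_def)
  show "\<pi> v \<noteq> v"
    using g\<pi> \<open>card M \<ge> 2\<close> by (auto split: if_splits)
  show "g (\<pi> v) = Suc (g v)" if "g (\<pi> v) \<noteq> 0"
    using g\<pi> that by (auto split: if_splits)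
qed

section \<open>Rotating a closed neighbourhood\<close>

context pair_graph
begin

text \<open>
  All of \<open>M\<close> is dominated by \<open>x\<close>, so the packing property leaves at most one vertex each of \<open>A\<close> and
  \<open>Y\<close> in \<open>M\<close>. Since \<open>\<pi>\<close> moves \<open>x\<close> and is the identity outside \<open>M\<close>, separation in the two copies shows
  that \<open>x\<close> belongs neither to \<open>A\<close> or \<open>Y\<close> nor to one of their images. Hence each copy contains a vertex
  that dominates \<open>x\<close> and differs from it, and these are \<open>p\<close> and \<open>\<pi> q\<close>. For the
  final inclusion, let \<open>v \<noteq> q\<close> be a vertex of \<open>M\<close> that \<open>\<pi> p\<close> dominates. It is dominated in the first copy by
  some \<open>a \<in> A\<close>, and \<open>a \<noteq> p\<close> would lie outside \<open>M\<close>, so that \<open>v\<close> would be dominated by both \<open>\<pi> p\<close> and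
  \<open>\<pi> a = a\<close>, contrary to the packing property of \<open>\<pi> ` A\<close>.
\<close>

lemma rotation_of_closed_nbhd:
  assumes x: "x \<in> pverts G" and M: "M = closed_nbhd G x"
    and \<pi>: "bij_betw \<pi> (pverts G) (pverts G)" and off: "\<And>v. v \<notin> M \<Longrightarrow> \<pi> v = v"
    and maps: "\<And>v. v \<in> M \<Longrightarrow> \<pi> v \<in> M" and moves: "\<And>v. v \<in> M \<Longrightarrow> \<pi> v \<noteq> v"
    and eq: "domination_number (prism \<pi> G) = domination_number G"
  obtains p q where "p \<in> M" "q \<in> M" "p \<noteq> x" "\<pi> p \<noteq> x" "\<pi> q \<noteq> x"
    "q \<notin> closed_nbhd G p" "\<pi> q \<notin> closed_nbhd G (\<pi> p)" "\<pi> q \<in> closed_nbhd G p"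
    "M \<inter> closed_nbhd G (\<pi> p) - {q} \<subseteq> closed_nbhd G p"
proof -
  let ?V = "pverts G" and ?N = "closed_nbhd G"
  interpret prism: pair_graph "prism \<pi> G"
    using \<pi> by (intro pair_graph_prism pair_graph_axioms)
  obtain D where D: "dominating_set (prism \<pi> G) D" "card D = domination_number G"
    using prism.domination_number_attained eq by auto
  obtain A Y where split: "split_dominates G A Y" and split': "split_dominates G (\<pi> ` Y) (\<pi> ` A)"
    and card: "card A + card Y = card D"
    using prism_dominating_set_splits[OF \<pi> D(1)] .
  have AV: "A \<subseteq> ?V" and YV: "Y \<subseteq> ?V"
    using split by (auto simp: split_dominates_def)
  then have inj: "inj_on \<pi> A" "inj_on \<pi> Y"
    using \<pi> by (auto simp: bij_betw_def intro: inj_on_subset)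
  have MV: "M \<subseteq> ?V" and xM: "x \<in> M"
    using x by (auto simp: M closed_nbhd_def)
  have min: "card A + card Y \<le> domination_number G"
    and min': "card (\<pi> ` Y) + card (\<pi> ` A) \<le> domination_number G"
    using card D(2) inj by (simp_all add: card_image)
  have cover: "v \<in> Y \<or> (\<exists>a \<in> A. v \<in> ?N a)" if "v \<in> ?V" for v
    using split that by (auto simp: split_dominates_def)
  have cover': "v \<in> \<pi> ` A \<or> (\<exists>y \<in> Y. v \<in> ?N (\<pi> y))" if "v \<in> ?V" for v
    using split' that by (auto simp: split_dominates_def)
  have sep: "y \<notin> ?N a" if "a \<in> A" "y \<in> Y" for a y
    using split_dominates_separated[OF split min that] .
  have sep': "\<pi> a \<notin> ?N (\<pi> y)" if "a \<in> A" "y \<in> Y" for a y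
    using split_dominates_separated[OF split' min'] that by blast
  have pack: "y = y'" if "y \<in> Y" "y \<in> ?N z" "y' \<in> Y" "y' \<in> ?N z" "z \<in> ?V" for y y' z
    using split_dominates_packing[OF split min that] .
  have pack': "a = a'" if "a \<in> A" "\<pi> a \<in> ?N z" "a' \<in> A" "\<pi> a' \<in> ?N z" "z \<in> ?V" for a a' z
    using split_dominates_packing[OF split' min'] that inj(1) by (blast dest: inj_onD)
  note comm = closed_nbhd_commute
  have A_one: "a = a'" if "a \<in> A \<inter> M" "a' \<in> A \<inter> M" for a a'
    using pack'[of a x a'] that maps x unfolding M by blast
  have Y_one: "y = y'" if "y \<in> Y \<inter> M" "y' \<in> Y \<inter> M" for y y'
    using pack[of y x y'] that x unfolding M by blast
  have meets: "z \<in> M" if "x \<in> ?N z" for z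
    using comm that unfolding M by blast
  have \<pi>V: "\<pi> v \<in> ?V" if "v \<in> ?V" for v
    using \<pi> that by (auto simp: bij_betw_def)
  have pre: "v \<in> M" if "\<pi> v \<in> M" for v
    using that off[of v] by (cases "v \<in> M") auto
  \<comment> \<open>With \<open>x \<in> A\<close>, the set \<open>Y\<close> avoids \<open>M\<close>, so \<open>\<pi> ` Y\<close> does not dominate \<open>x\<close>, while \<open>\<pi> x \<noteq> x\<close> is the
    only vertex of \<open>\<pi> ` A\<close> in \<open>M\<close>.\<close>
  have "x \<notin> A"
  proof
    assume xA: "x \<in> A"
    then have noY: "Y \<inter> M = {}"
      using sep unfolding M by blast
    from cover'[OF x] show False
    proof
      assume "x \<in> \<pi> ` A"
      then obtain a where "a \<in> A" "\<pi> a = x" by blast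
      then show False
        using A_one[of a x] pre[of a] xA xM moves[of x] by auto
    next
      assume "\<exists>y \<in> Y. x \<in> ?N (\<pi> y)"
      then obtain y where "y \<in> Y" "\<pi> y \<in> M"
        using meets by blast
      then show False
        using pre noY by blast
    qed
  qed
  \<comment> \<open>With \<open>x \<in> Y\<close>, the vertex \<open>\<pi> x\<close> is dominated in the first copy by some \<open>a \<in> A\<close> that \<open>\<pi>\<close> fixes,
    but in the second copy \<open>\<pi> a = a\<close> and \<open>\<pi> x\<close> have to be separated.\<close>
  have "x \<notin> Y"
  proof
    assume xY: "x \<in> Y"
    then have "\<pi> x \<notin> Y"
      using Y_one[of x "\<pi> x"] xM maps[of x] moves[of x] by auto
    then obtain a where a: "a \<in> A" "\<pi> x \<in> ?N a"
      using cover \<pi>V x by blast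
    have "a \<notin> M"
      using sep[OF a(1) xY] comm[of a x] unfolding M by blast
    then show False
      using sep'[OF a(1) xY] comm[OF a(2)] off[of a] by simp
  qed
  then obtain p where p: "p \<in> A" "p \<in> M"
    using cover[OF x] meets by blast
  have p_only: "a = p" if "a \<in> A" "a \<in> M" for a
    using A_one p that by blast
  have "x \<notin> \<pi> ` Y"
  proof
    assume "x \<in> \<pi> ` Y"
    then obtain y where "y \<in> Y" "\<pi> y = x" by blast
    then show False
      using sep'[OF p(1)] maps[OF p(2)] unfolding M by blast
  qed
  \<comment> \<open>The mirror image of the argument for \<open>x \<notin> Y\<close>, with the two copies exchanged.\<close>
  have px: "\<pi> p \<noteq> x"
  proof
    assume px: "\<pi> p = x"
    have "p \<notin> \<pi> ` A"
    proof
      assume "p \<in> \<pi> ` A"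
      then obtain a where "a \<in> A" "\<pi> a = p" by blast
      then show False
        using pre[of a] p p_only[of a] moves[of p] by auto
    qed
    then obtain y where y: "y \<in> Y" "p \<in> ?N (\<pi> y)"
      using cover' p(2) MV by blast
    have "\<pi> y \<notin> M"
      using sep'[OF p(1) y(1)] comm[of "\<pi> y" x] unfolding px M by blast
    then have "\<pi> y = y"
      using maps[of y] off[of y] by blast
    then show False
      using sep[OF p(1) y(1)] comm[of p y] y(2) by simp
  qed
  have "x \<notin> \<pi> ` A"
    using px pre xM p_only by (metis imageE)
  then obtain q where q: "q \<in> Y" "x \<in> ?N (\<pi> q)"
    using cover'[OF x] by blast
  have \<pi>qM: "\<pi> q \<in> M"
    using q meets by blast
  then have qM: "q \<in> M"
    by (rule pre)
  have q_only: "y = q" if "y \<in> Y" "y \<in> M" for y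
    using Y_one q(1) qM that by blast
  show ?thesis
  proof
    show "p \<in> M" "q \<in> M" "\<pi> p \<noteq> x"
      by (fact p qM px)+
    show "p \<noteq> x" "\<pi> q \<noteq> x"
      using \<open>x \<notin> A\<close> \<open>x \<notin> \<pi> ` Y\<close> p q by auto
    show "q \<notin> ?N p"
      using sep p q by blast
    show "\<pi> q \<notin> ?N (\<pi> p)"
      using sep'[OF p(1) q(1)] comm[of "\<pi> q" "\<pi> p"] by blast
    have "\<pi> q \<notin> Y"
      using q_only[of "\<pi> q"] \<pi>qM moves[of q] qM by auto
    then obtain a where a: "a \<in> A" "\<pi> q \<in> ?N a"
      using cover \<pi>qM MV by blast
    have "a \<in> M"
    proof (rule ccontr)
      assume "a \<notin> M"
      then show False
        using sep'[OF a(1) q(1)] comm[OF a(2)] off[of a] by simp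
    qed
    then show "\<pi> q \<in> ?N p"
      using a p_only by blast
    show "M \<inter> ?N (\<pi> p) - {q} \<subseteq> ?N p"
    proof
      fix v assume v: "v \<in> M \<inter> ?N (\<pi> p) - {q}"
      then have "v \<notin> Y"
        using q_only by blast
      then obtain a where a: "a \<in> A" "v \<in> ?N a"
        using cover v MV by blast
      have "a = p"
      proof (cases "a \<in> M")
        case False
        then show ?thesis
          using pack'[of a v p] a p(1) v comm[of v a] comm[of v "\<pi> p"] off[of a] MV by auto
      qed (use a p_only in blast)
      with a show "v \<in> ?N p" by simp
    qed
  qed
qed

text \<open>
  In the notation of the proof, \<open>W v\<close> is \<open>sum g (S v)\<close>. The inclusion of closed neighbourhoods pushes
  this sum down along the step from \<open>p\<close> to \<open>\<pi> p\<close>, and optimality of \<open>g\<close> forbids it to decrease.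
\<close>

lemma not_universal_fixer_if_edge:
  assumes edge: "(x, w) \<in> parcs G"
  shows "\<not> universal_fixer G"
proof
  assume fixer: "universal_fixer G"
  define M where "M = closed_nbhd G x"
  have x: "x \<in> pverts G" and w: "w \<in> pverts G" "w \<noteq> x"
    using edge no_loops' by (auto dest: in_arcsD1 in_arcsD2)
  have M: "finite M" "M \<subseteq> pverts G" "x \<in> M" "w \<in> M"
    using x w edge by (auto simp: M_def closed_nbhd_def)
  have "card {x, w} \<le> card M"
    using M by (intro card_mono) auto
  then have card: "card M \<ge> 2"
    using w by simp
  define R where "R u v \<longleftrightarrow> v \<in> closed_nbhd G u" for u v
  have R_refl: "R v v" if "v \<in> M" for v
    using that M by (auto simp: R_def closed_nbhd_def)
  have R_sym: "R v u" if "R u v" for u v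
    using that closed_nbhd_commute by (simp add: R_def)
  obtain g :: "'a \<Rightarrow> nat" where g: "bij_betw g M {..<card M}" "g x = 0"
    and opt: "\<And>p p'. \<lbrakk>p \<in> M; p' \<in> M; p \<noteq> x; g p' = Suc (g p)\<rbrakk>
      \<Longrightarrow> (\<Sum>v | v \<in> M \<and> R p v. g v) \<le> (\<Sum>v | v \<in> M \<and> R p' v. g v)"
    by (rule exists_optimal_numbering[of M x R, OF M(1,3)]) (assumption | rule R_refl R_sym that)+
  obtain \<pi> where \<pi>: "bij_betw \<pi> (pverts G) (pverts G)" "\<And>v. v \<notin> M \<Longrightarrow> \<pi> v = v"
      "\<And>v. v \<in> M \<Longrightarrow> \<pi> v \<in> M" "\<And>v. v \<in> M \<Longrightarrow> \<pi> v \<noteq> v"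
    and step: "\<And>v. \<lbrakk>v \<in> M; g (\<pi> v) \<noteq> 0\<rbrakk> \<Longrightarrow> g (\<pi> v) = Suc (g v)"
    by (rule rotation_along_numbering[OF M(2) g(1) card]) (assumption | rule that)+
  have eq: "domination_number (prism \<pi> G) = domination_number G"
    using fixer \<pi>(1) by (simp add: universal_fixer_def)
  obtain p q where pq: "p \<in> M" "q \<in> M" "p \<noteq> x" "\<pi> p \<noteq> x" "\<pi> q \<noteq> x"
    and out: "q \<notin> closed_nbhd G p" "\<pi> q \<notin> closed_nbhd G (\<pi> p)" and near: "\<pi> q \<in> closed_nbhd G p"
    and incl: "M \<inter> closed_nbhd G (\<pi> p) - {q} \<subseteq> closed_nbhd G p"
    by (rule rotation_of_closed_nbhd[OF x M_def \<pi> eq]) (assumption | rule that)+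
  have succ: "g (\<pi> v) = Suc (g v)" if "v \<in> M" "\<pi> v \<noteq> x" for v
  proof -
    have "g (\<pi> v) \<noteq> g x"
      using that \<pi>(3)[of v] g(1) M(3) by (auto simp: bij_betw_def dest: inj_onD)
    then show ?thesis
      using step[of v] that g(2) by simp
  qed
  define S where "S u = {v. v \<in> M \<and> R u v}" for u
  have S: "S u = M \<inter> closed_nbhd G u" if "u \<in> M" for u
    using that M by (auto simp: S_def R_def)
  have fin: "finite (S u)" for u
    using M by (simp add: S_def)
  have \<pi>q: "\<pi> q \<in> S p" "\<pi> q \<notin> S (\<pi> p)" "q \<notin> S p"
    using pq out near \<pi>(3)[of p] \<pi>(3)[of q] by (simp_all add: S)
  have "S (\<pi> p) - {q} \<subseteq> S p - {\<pi> q}"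
    using incl \<pi>q(2) S[OF pq(1)] S[OF \<pi>(3)[OF pq(1)]] by blast
  then have "sum g (S (\<pi> p) - {q}) \<le> sum g (S p - {\<pi> q})"
    using fin by (intro sum_mono2) auto
  moreover have "sum g (S p) = g (\<pi> q) + sum g (S p - {\<pi> q})"
    using \<pi>q fin by (intro sum.remove)
  moreover have "sum g (S (\<pi> p)) \<le> g q + sum g (S (\<pi> p) - {q})"
    by (cases "q \<in> S (\<pi> p)") (simp_all add: sum.remove fin)
  ultimately have "sum g (S (\<pi> p)) < sum g (S p)"
    using succ[OF pq(2,5)] by linarith
  moreover have "sum g (S p) \<le> sum g (S (\<pi> p))"
    using opt[OF pq(1) \<pi>(3)[OF pq(1)] pq(3) succ[OF pq(1,4)]] by (simp add: S_def)
  ultimately show False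
    by simp
qed

section \<open>Connected graphs are not universal fixers\<close>

lemma connected_nontrivial_has_edge:
  assumes conn: "Digraph_Component.connected (with_proj G)" and "card (pverts G) \<ge> 2"
  shows "parcs G \<noteq> {}"
proof
  assume empty: "parcs G = {}"
  obtain u v where uv: "u \<in> pverts G" "v \<in> pverts G" "u \<noteq> v"
    using assms(2) card_le_Suc0_iff_eq[of "pverts G"] by fastforce
  then have "u \<rightarrow>\<^sup>*\<^bsub>with_proj (mk_symmetric G)\<^esub> v"
    using conn by (simp add: connected_def strongly_connected_def)
  then have "v = u"
    using empty by (auto simp: reachable_def parcs_mk_symmetric elim: rtrancl_on.cases)
  with uv show False
    by simp
qed

end

theorem theorem1p3:
  fixes G :: "'a pair_pre_digraph" and n :: nat
  assumes "pair_graph G"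
    and "card (pverts G) = n"
    and "n \<ge> 2"
    and "Digraph_Component.connected (with_proj G)"
    and "domination_number G \<ge> 4"
  shows "universal_fixer G \<longleftrightarrow> digraph_iso (with_proj G) (with_proj (edgeless_graph n))"
proof -
  interpret pair_graph G
    by fact
  obtain x w where edge: "(x, w) \<in> parcs G"
    using connected_nontrivial_has_edge assms by auto
  have "\<not> digraph_iso (with_proj G) (with_proj (edgeless_graph n))"
  proof
    assume "digraph_iso (with_proj G) (with_proj (edgeless_graph n))"
    then obtain f where "with_proj (edgeless_graph n) = app_iso f (with_proj G)"
      by (auto simp: digraph_iso_def)
    then have "arcs (with_proj (edgeless_graph n)) = iso_arcs f ` arcs (with_proj G)"
      by (simp only: arcs_app_iso)
    with edge show False
      by (auto simp: edgeless_graph_def)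
  qed
  with not_universal_fixer_if_edge[OF edge] show ?thesis
    by simp
qed

end
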